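(* Let $n$ and $k$ be integers with $2\leqslant k\leqslant n-1$. Then $$|\mathcal{F}_n^{k-1}[n\prec 1]|=n\,|\mathcal{F}_n^{k}[n\prec 1]|.$$
   Context: Write $[n]=\{1,\ldots,n\}$. For $1\leqslant k\leqslant n$, $\mathcal{F}_n^k$ denotes the set of forests with vertex set $[n]$ that consist of exactly $k$ rooted (non-plane, labeled) trees whose roots are $1,\ldots,k$ respectively. For a vertex $x$ of a forest $F$, $F_x$ denotes the subtree of $F$ rooted at $x$; a vertex $y$ is a descendant of $x$, written $y\prec x$, if $y$ is a vertex of $F_x$, i.e. $x$ lies on the path from the root of the tree containing $y$ to $y$. $\mathcal{F}_n^k[n\prec 1]$ denotes the subset of those forests in $\mathcal{F}_n^k$ in which $n\prec 1$, i.e. vertex $n$ lies in the tree rooted at $1$. *)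

theory Defs
  imports Main
begin

text \<open>A simple graph on a vertex set \<open>V\<close> is given by its set of edges, each edge being a
  two-element subset of \<open>V\<close>.\<close>

definition simple_graph :: "'a set \<Rightarrow> 'a set set \<Rightarrow> bool" where
  "simple_graph V E \<longleftrightarrow> (\<forall>e\<in>E. e \<subseteq> V \<and> card e = 2)"

definition is_path :: "'a set set \<Rightarrow> 'a \<Rightarrow> 'a list \<Rightarrow> 'a \<Rightarrow> bool" where
  "is_path E u p v \<longleftrightarrow>
     p \<noteq> [] \<and> hd p = u \<and> last p = v \<and> distinct p \<and> successively (\<lambda>x y. {x, y} \<in> E) p"

text \<open>A cycle is listed without repeating its first vertex at the end; the bound on the length
  excludes going back and forth along a single edge.\<close>

definition is_cycle :: "'a set set \<Rightarrow> 'a list \<Rightarrow> bool" where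
  "is_cycle E p \<longleftrightarrow>
     length p \<ge> 3 \<and> distinct p \<and> successively (\<lambda>x y. {x, y} \<in> E) p \<and> {last p, hd p} \<in> E"

text \<open>The forests and trees of the entry \<open>Graph_Theory\<close> are not used: there a digraph is a
  forest if it has no directed cycle, which is a different notion.\<close>

definition is_forest :: "'a set \<Rightarrow> 'a set set \<Rightarrow> bool" where
  "is_forest V E \<longleftrightarrow> simple_graph V E \<and> (\<nexists>p. is_cycle E p)"

definition components :: "'a set \<Rightarrow> 'a set set \<Rightarrow> 'a set set" where
  "components V E = V // {(u, v). u \<in> V \<and> v \<in> V \<and> (\<exists>p. is_path E u p v)}"

text \<open>A rooted forest is represented by its edge set alone, as the roots are prescribed: each
  of \<open>1, \<dots>, k\<close> is the root of the one tree that contains it.\<close>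

definition rooted_forests :: "nat \<Rightarrow> nat \<Rightarrow> nat set set set" where
  "rooted_forests n k =
     {E. is_forest {1..n} E \<and> card (components {1..n} E) = k \<and>
         (\<forall>T\<in>components {1..n} E. \<exists>!r. r \<in> {1..k} \<and> r \<in> T)}"

text \<open>\<open>descendant k E y x\<close> is \<open>y \<prec> x\<close> (reflexive: \<open>x\<close> belongs to the subtree \<open>F\<^sub>x\<close>) in the forest
  with edge set \<open>E\<close> and roots \<open>1, \<dots>, k\<close>. The root of the tree of \<open>y\<close> is the only element of
  \<open>{1..k}\<close> from which there is a path to \<open>y\<close>.\<close>

definition descendant :: "nat \<Rightarrow> nat set set \<Rightarrow> nat \<Rightarrow> nat \<Rightarrow> bool" where
  "descendant k E y x \<longleftrightarrow> (\<exists>r\<in>{1..k}. \<exists>p. is_path E r p y \<and> x \<in> set p)"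

definition rooted_forests_desc :: "nat \<Rightarrow> nat \<Rightarrow> nat \<Rightarrow> nat \<Rightarrow> nat set set set" where
  "rooted_forests_desc n k y x = {E \<in> rooted_forests n k. descendant k E y x}"

end

theory Submission
  imports Defs
begin

text \<open>Detaching the subtree of \<open>k\<close> from its parent \<open>v\<close> turns a forest with roots
  \<open>1, \<dots>, k - 1\<close> into one with roots \<open>1, \<dots>, k\<close>; the pair of the new forest and \<open>v\<close> determines
  the old one, and \<open>v\<close> may be any vertex outside the tree \<open>T\<^sub>k\<close> of \<open>k\<close>. In the old forest \<open>n\<close> lies
  below \<open>1\<close> iff in the new one \<open>n \<in> T\<^sub>1\<close> (leaving \<open>n - |T\<^sub>k|\<close> choices of \<open>v\<close>), or \<open>n \<in> T\<^sub>k\<close> and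
  \<open>v \<in> T\<^sub>1\<close> (leaving \<open>|T\<^sub>1|\<close> choices). Exchanging the labels \<open>1\<close> and \<open>k\<close> shows that the second
  kind contributes the sum of \<open>|T\<^sub>k|\<close> over the forests of the first kind, so that each of these
  accounts for \<open>n\<close> forests in total.\<close>

section \<open>Connectivity in graphs\<close>

text \<open>Reachability by walks that may repeat vertices, so that walks can be concatenated
  freely. No vertex set is involved: every point reaches itself.\<close>

definition connected :: "'a set set \<Rightarrow> 'a \<Rightarrow> 'a \<Rightarrow> bool" where
  "connected E = (\<lambda>x y. {x, y} \<in> E)\<^sup>*\<^sup>*"

lemma connected_refl [simp]: "connected E x x"
  by (simp add: connected_def)

lemma connected_trans: "connected E x y \<Longrightarrow> connected E y z \<Longrightarrow> connected E x z"
  unfolding connected_def by (rule rtranclp_trans)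

lemma connected_step: "connected E x y \<Longrightarrow> {y, z} \<in> E \<Longrightarrow> connected E x z"
  unfolding connected_def by (rule rtranclp.rtrancl_into_rtrancl)

lemma step_connected: "{x, y} \<in> E \<Longrightarrow> connected E y z \<Longrightarrow> connected E x z"
  unfolding connected_def by (rule converse_rtranclp_into_rtranclp)

lemmas connected_induct [consumes 1, case_names base step] =
  rtranclp_induct[of "\<lambda>x y. {x, y} \<in> E" for E, folded connected_def]

lemmas converse_connected_induct [consumes 1, case_names base step] =
  converse_rtranclp_induct[of "\<lambda>x y. {x, y} \<in> E" for E, folded connected_def]

lemma connected_sym: "connected E x y \<Longrightarrow> connected E y x"
proof (induction rule: connected_induct)
  case (step y z)
  then have "{z, y} \<in> E" by (simp add: insert_commute)
  with step.IH show ?case by (meson step_connected)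
qed simp

lemma connected_mono: "connected E x y \<Longrightarrow> E \<subseteq> E' \<Longrightarrow> connected E' x y"
proof (induction rule: connected_induct)
  case (step y z)
  then show ?case by (meson connected_step subsetD)
qed simp

lemma connected_edge: "{x, y} \<in> E \<Longrightarrow> connected E x y"
  by (rule connected_step[OF connected_refl])

text \<open>Stated for all vertices of the path, because \<open>descendant\<close> speaks of a
  vertex somewhere on a path from a root.\<close>

lemma is_path_connected: "is_path E u p v \<Longrightarrow> w \<in> set p \<Longrightarrow> connected E u w"
proof (induction p arbitrary: u)
  case (Cons a p)
  show ?case
  proof (cases "p = [] \<or> w = a")
    case True
    then show ?thesis using Cons.prems by (auto simp: is_path_def)
  next
    case False
    then have "is_path E (hd p) p v" "w \<in> set p" "{u, hd p} \<in> E"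
      using Cons.prems by (auto simp: is_path_def successively_Cons)
    then show ?thesis
      using Cons.IH by (meson step_connected)
  qed
qed (simp add: is_path_def)

lemma connected_is_path: "connected E u v \<Longrightarrow> \<exists>p. is_path E u p v"
proof (induction rule: connected_induct)
  case base
  have "is_path E u [u] u" by (simp add: is_path_def)
  then show ?case ..
next
  case (step y z)
  then obtain p where p: "is_path E u p y" by blast
  show ?case
  proof (cases "z \<in> set p")
    \<comment> \<open>When the walk returns to a vertex already listed, the path is cut off at that
      vertex.\<close>
    case True
    then obtain q r where qr: "p = q @ z # r" by (meson split_list)
    have "is_path E u (q @ [z]) z"
      using p unfolding qr is_path_def
      by (cases q) (auto simp: successively_append_iff successively_Cons hd_append)
    then show ?thesis ..
  next
    case False
    have "is_path E u (p @ [z]) z"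
      using p False step.hyps by (auto simp: is_path_def successively_append_iff)
    then show ?thesis ..
  qed
qed

lemma ex_path_iff_connected: "(\<exists>p. is_path E u p v) \<longleftrightarrow> connected E u v"
proof
  assume "\<exists>p. is_path E u p v"
  then obtain p where p: "is_path E u p v" ..
  then have "v \<in> set p" by (auto simp: is_path_def)
  with p show "connected E u v" by (rule is_path_connected)
qed (rule connected_is_path)

text \<open>A walk that crosses the new edge several times can be shortened to cross it at most
  once; the last two alternatives are the two directions of the crossing.\<close>

lemma connected_insert:
  "connected (insert {a, b} E) x y \<longleftrightarrow>
     connected E x y \<or> connected E x a \<and> connected E b y \<or> connected E x b \<and> connected E a y"
  (is "?L \<longleftrightarrow> ?R")
proof
  assume ?L
  then show ?R
  proof (induction rule: connected_induct)
    case (step y z)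
    show ?case
    proof (cases "{y, z} \<in> E")
      case True
      with step.IH show ?thesis by (meson connected_step)
    next
      case False
      with step.hyps have "y = a \<and> z = b \<or> y = b \<and> z = a" by (auto simp: doubleton_eq_iff)
      with step.IH show ?thesis by auto
    qed
  qed simp
next
  have mono: "connected (insert {a, b} E) u v" if "connected E u v" for u v
    using that by (rule connected_mono) auto
  have ab: "connected (insert {a, b} E) a b" "connected (insert {a, b} E) b a"
    by (auto intro!: connected_edge simp: insert_commute)
  assume ?R
  then show ?L using mono ab by (meson connected_trans)
qed

text \<open>Cut a walk from \<open>r\<close> to \<open>k\<close> at its first arrival in
  \<open>k\<close>; \<open>v\<close> is the vertex just before. In a forest with \<open>r\<close> as
  root of the tree, \<open>v\<close> is the parent of \<open>k\<close>.\<close>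

lemma connected_last_edge:
  assumes "connected E r k" and "r \<noteq> k"
  obtains v where "{k, v} \<in> E" and "connected (E - {{k, v}}) r v"
proof -
  \<comment> \<open>Avoiding every edge at \<open>k\<close> is stronger than avoiding
    \<open>{k, v}\<close>, but it does not mention \<open>v\<close> and so carries through the
    induction.\<close>
  have "r = k \<or> (\<exists>v. {k, v} \<in> E \<and> connected {e \<in> E. k \<notin> e} r v)"
    using assms(1)
  proof (induction rule: converse_connected_induct)
    case (step x y)
    show ?case
    proof (cases "x = k \<or> y = k")
      case True
      with step.hyps show ?thesis by (auto simp: insert_commute)
    next
      case False
      with step.IH obtain v where v: "{k, v} \<in> E" "connected {e \<in> E. k \<notin> e} y v" by blast
      have "{x, y} \<in> {e \<in> E. k \<notin> e}" using False step.hyps by auto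
      with v show ?thesis by (meson step_connected)
    qed
  qed simp
  then obtain v where v: "{k, v} \<in> E" "connected {e \<in> E. k \<notin> e} r v"
    using assms(2) by blast
  have "connected (E - {{k, v}}) r v"
    using v(2) by (rule connected_mono) auto
  with v(1) show thesis by (rule that)
qed

lemma connected_image:
  assumes "connected E x y"
  shows "connected ((`) f ` E) (f x) (f y)"
  using assms
proof (induction rule: connected_induct)
  case (step y z)
  have "{f y, f z} = f ` {y, z}" by simp
  with step.hyps have "{f y, f z} \<in> (`) f ` E" by (metis imageI)
  with step.IH show ?case by (meson connected_step)
qed simp

section \<open>Forests\<close>

text \<open>Acyclicity in terms of reachability alone, which suits insertion and removal of edges
  better than lists of vertices. Loops are excluded as well, as \<open>x\<close> reaches
  itself.\<close>

definition all_bridges :: "'a set set \<Rightarrow> bool" where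
  "all_bridges E \<longleftrightarrow> (\<forall>x y. {x, y} \<in> E \<longrightarrow> \<not> connected (E - {{x, y}}) x y)"

text \<open>An edge that is not a bridge closes the path around it to a cycle; conversely, the rest
  of a cycle connects the ends of its closing edge.\<close>

lemma no_cycle_iff_all_bridges:
  assumes "simple_graph V E"
  shows "(\<nexists>p. is_cycle E p) \<longleftrightarrow> all_bridges E"
proof
  assume nc: "\<nexists>p. is_cycle E p"
  show "all_bridges E"
    unfolding all_bridges_def
  proof (intro allI impI notI)
    fix x y assume xy: "{x, y} \<in> E" and "connected (E - {{x, y}}) x y"
    then obtain p where p: "is_path (E - {{x, y}}) x p y"
      using connected_is_path by metis
    have "x \<noteq> y"
      using xy assms by (auto simp: simple_graph_def)
    then obtain q where q: "p = x # q" "q \<noteq> []"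
      using p by (cases p) (auto simp: is_path_def split: if_splits)
    \<comment> \<open>A path of only two vertices would be the removed edge itself.\<close>
    have "tl q \<noteq> []"
      using p q by (cases q) (auto simp: is_path_def)
    then have "length p \<ge> 3"
      using q by (cases q; cases "tl q") auto
    moreover have "successively (\<lambda>x y. {x, y} \<in> E) p"
      using p unfolding is_path_def by (auto elim: successively_mono)
    moreover have "{y, x} \<in> E"
      using xy by (simp add: insert_commute)
    ultimately have "is_cycle E p"
      using p by (auto simp: is_cycle_def is_path_def)
    with nc show False by blast
  qed
next
  assume ab: "all_bridges E"
  show "\<nexists>p. is_cycle E p"
  proof
    assume "\<exists>p. is_cycle E p"
    then obtain p where len: "length p \<ge> 3" and d: "distinct p"
      and s: "successively (\<lambda>x y. {x, y} \<in> E) p" and e: "{last p, hd p} \<in> E"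
      by (auto simp: is_cycle_def)
    let ?E = "E - {{hd p, last p}}"
    have "p \<noteq> []" using len by auto
    \<comment> \<open>The closing edge does not recur inside the list: its ends sit at the first and
      last positions, which are not adjacent when there are at least three vertices.\<close>
    have "{p ! i, p ! Suc i} \<noteq> {hd p, last p}" if "Suc i < length p" for i
    proof
      assume eq: "{p ! i, p ! Suc i} = {hd p, last p}"
      have hl: "hd p = p ! 0" "last p = p ! (length p - 1)"
        using \<open>p \<noteq> []\<close> by (auto simp: hd_conv_nth last_conv_nth)
      have idx: "0 < length p" "length p - 1 < length p" "i < length p" using that by auto
      from eq have "i = 0 \<and> Suc i = length p - 1 \<or> i = length p - 1 \<and> Suc i = 0"
        unfolding hl doubleton_eq_iff using idx that d by (metis nth_eq_iff_index_eq)
      then show False using len by auto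
    qed
    then have "successively (\<lambda>x y. {x, y} \<in> ?E) p"
      using s by (auto simp: successively_conv_nth)
    then have "is_path ?E (hd p) p (last p)"
      using d \<open>p \<noteq> []\<close> by (auto simp: is_path_def)
    then have "connected ?E (hd p) (last p)"
      using ex_path_iff_connected by metis
    moreover have "{hd p, last p} \<in> E" using e by (simp add: insert_commute)
    ultimately show False using ab by (auto simp: all_bridges_def)
  qed
qed

lemma all_bridges_subset: "all_bridges E \<Longrightarrow> E' \<subseteq> E \<Longrightarrow> all_bridges E'"
  unfolding all_bridges_def by (blast intro: connected_mono)

text \<open>A detour around an old edge \<open>{x, y}\<close> must cross the new edge; its remaining
  pieces, joined by \<open>{x, y}\<close>, would connect \<open>a\<close> and \<open>b\<close> in
  \<open>E\<close>.\<close>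

lemma all_bridges_insert:
  assumes "all_bridges E" and nc: "\<not> connected E a b"
  shows "all_bridges (insert {a, b} E)"
  unfolding all_bridges_def
proof (intro allI impI notI)
  fix x y
  assume xy: "{x, y} \<in> insert {a, b} E"
    and c: "connected (insert {a, b} E - {{x, y}}) x y"
  show False
  proof (cases "{x, y} = {a, b}")
    case True
    have "connected E x y" using c by (rule connected_mono) (use True in auto)
    with True nc show False by (metis connected_sym doubleton_eq_iff)
  next
    case False
    let ?E = "E - {{x, y}}"
    have "{x, y} \<in> E" using xy False by auto
    moreover have "insert {a, b} E - {{x, y}} = insert {a, b} ?E"
      using False by auto
    ultimately have "connected ?E x a \<and> connected ?E b y \<or> connected ?E x b \<and> connected ?E a y"
      using c assms(1) by (auto simp: connected_insert all_bridges_def)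
    then have "connected E x a \<and> connected E b y \<or> connected E x b \<and> connected E a y"
      by (metis Diff_subset connected_mono)
    moreover have "connected E x y" using \<open>{x, y} \<in> E\<close> by (rule connected_edge)
    ultimately show False using nc by (meson connected_sym connected_trans)
  qed
qed

text \<open>A detour around an image edge is pulled back along \<open>inv f\<close>; by injectivity,
  it avoids the original edge.\<close>

lemma all_bridges_image:
  assumes "all_bridges E" and "inj f"
  shows "all_bridges ((`) f ` E)"
  unfolding all_bridges_def
proof (intro allI impI notI)
  fix x y
  assume "{x, y} \<in> (`) f ` E" and c: "connected ((`) f ` E - {{x, y}}) x y"
  then obtain e where e: "e \<in> E" "{x, y} = f ` e" by blast
  from e(2) obtain u v where uv: "x = f u" "y = f v" by blast
  have "f ` {u, v} = f ` e" using e(2) uv by simp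
  then have "e = {u, v}" using assms(2) inj_image_eq_iff by metis
  have "(`) (inv f) ` ((`) f ` E - {{x, y}}) \<subseteq> E - {{u, v}}"
    using assms(2) by (auto simp: uv image_image)
  moreover have "connected ((`) (inv f) ` ((`) f ` E - {{x, y}})) u v"
    using connected_image[OF c, of "inv f"] assms(2) by (simp add: uv)
  ultimately have "connected (E - {{u, v}}) u v" by (rule connected_mono[rotated])
  with assms(1) e(1) \<open>e = {u, v}\<close> show False by (auto simp: all_bridges_def)
qed

section \<open>Rooted forests\<close>

lemma components_eq:
  "components V E = (\<lambda>v. {w \<in> V. connected E v w}) ` V"
  by (auto simp: components_def quotient_def ex_path_iff_connected)

text \<open>Sending a root to its component is a bijection from \<open>{1..k}\<close> onto the
  components, which gives their number. The bound \<open>k \<le> n\<close> makes all roots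
  vertices.\<close>

lemma rooted_forests_iff:
  assumes "k \<le> n"
  shows "E \<in> rooted_forests n k \<longleftrightarrow>
    simple_graph {1..n} E \<and> all_bridges E \<and> (\<forall>v\<in>{1..n}. \<exists>!r. r \<in> {1..k} \<and> connected E v r)"
proof -
  let ?C = "\<lambda>v. {w \<in> {1..n}. connected E v w}"
  have roots: "(\<forall>T\<in>components {1..n} E. \<exists>!r. r \<in> {1..k} \<and> r \<in> T) \<longleftrightarrow>
      (\<forall>v\<in>{1..n}. \<exists>!r. r \<in> {1..k} \<and> connected E v r)"
  proof -
    have "(r \<in> {1..k} \<and> r \<in> ?C v) \<longleftrightarrow> (r \<in> {1..k} \<and> connected E v r)" for r v
      using assms by auto
    then show ?thesis by (simp add: components_eq)
  qed
  have "card (components {1..n} E) = k"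
    if R: "\<forall>v\<in>{1..n}. \<exists>!r. r \<in> {1..k} \<and> connected E v r"
  proof -
    have sub: "{1..k} \<subseteq> {1..n}" using assms by auto
    have "?C ` {1..n} = ?C ` {1..k}"
    proof
      show "?C ` {1..n} \<subseteq> ?C ` {1..k}"
      proof
        fix T assume "T \<in> ?C ` {1..n}"
        then obtain v where v: "v \<in> {1..n}" "T = ?C v" by blast
        then obtain r where r: "r \<in> {1..k}" "connected E v r" using R by blast
        then have "T = ?C r"
          unfolding v(2) by (auto intro: connected_trans connected_sym)
        with r(1) show "T \<in> ?C ` {1..k}" by blast
      qed
    qed (use sub in auto)
    moreover have "inj_on ?C {1..k}"
    proof (rule inj_onI)
      fix r s assume r: "r \<in> {1..k}" and s: "s \<in> {1..k}" and eq: "?C r = ?C s"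
      have "s \<in> ?C s" using s sub by auto
      then have "connected E r s" using eq by blast
      moreover have "r \<in> {1..n}" using r sub by blast
      ultimately show "r = s" using R r s connected_refl by metis
    qed
    ultimately show ?thesis by (simp add: components_eq card_image)
  qed
  then show ?thesis
    using no_cycle_iff_all_bridges[of "{1..n}" E]
    by (auto simp only: rooted_forests_def is_forest_def roots mem_Collect_eq)
qed

context
  fixes n k :: nat and E :: "nat set set"
  assumes kn: "k \<le> n" and E: "E \<in> rooted_forests n k"
begin

lemma rooted_forests_root:
  assumes "v \<in> {1..n}"
  obtains r where "r \<in> {1..k}" "connected E v r"
  using E assms unfolding rooted_forests_iff[OF kn] by blast

lemma rooted_forests_root_unique:
  assumes "r \<in> {1..k}" "s \<in> {1..k}" "connected E r s"
  shows "r = s"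
proof -
  have "r \<in> {1..n}" using assms(1) kn by auto
  then show ?thesis
    using E assms connected_refl unfolding rooted_forests_iff[OF kn] by metis
qed

text \<open>A path from a root \<open>r\<close> through the root \<open>x\<close> forces
  \<open>r = x\<close>, as no tree has two roots.\<close>

lemma descendant_root_iff:
  assumes "x \<in> {1..k}"
  shows "descendant k E y x \<longleftrightarrow> connected E x y"
proof
  assume "descendant k E y x"
  then obtain r p where rp: "r \<in> {1..k}" "is_path E r p y" "x \<in> set p"
    unfolding descendant_def by blast
  then have "r = x"
    using assms by (metis is_path_connected rooted_forests_root_unique)
  then show "connected E x y"
    using rp ex_path_iff_connected by metis
next
  assume "connected E x y"
  then obtain p where p: "is_path E x p y" using connected_is_path by metis
  then have "x \<in> set p" by (auto simp: is_path_def)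
  with p assms show "descendant k E y x" unfolding descendant_def by blast
qed

end

text \<open>Uniqueness need only be checked between roots: two roots reached from the same vertex
  are connected through it.\<close>

lemma rooted_forestsI:
  assumes "k \<le> n" "simple_graph {1..n} E" "all_bridges E"
    and "\<And>v. v \<in> {1..n} \<Longrightarrow> \<exists>r\<in>{1..k}. connected E v r"
    and "\<And>r s. r \<in> {1..k} \<Longrightarrow> s \<in> {1..k} \<Longrightarrow> connected E r s \<Longrightarrow> r = s"
  shows "E \<in> rooted_forests n k"
  unfolding rooted_forests_iff[OF assms(1)] Ex1_def Bex_def
  using assms(2-5) by (metis connected_sym connected_trans)

lemma rooted_forests_desc_root:
  assumes "k \<le> n" "x \<in> {1..k}"
  shows "rooted_forests_desc n k y x = {E \<in> rooted_forests n k. connected E x y}"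
  using descendant_root_iff[OF assms(1) _ assms(2)]
  by (auto simp: rooted_forests_desc_def)

lemma finite_rooted_forests: "finite (rooted_forests n k)"
proof (rule finite_subset)
  show "rooted_forests n k \<subseteq> Pow (Pow {1..n})"
    by (auto simp: rooted_forests_def is_forest_def simple_graph_def)
qed simp

section \<open>Attaching and detaching the tree of the last root\<close>

text \<open>The root of \<open>v\<close> takes over the tree of \<open>k\<close>. No two of the
  other roots are merged, since the new edge ends in \<open>k\<close>, which none of them reaches in
  \<open>E\<close>.\<close>

lemma attach_root:
  assumes k: "1 < k" "k \<le> n" and E: "E \<in> rooted_forests n k"
    and v: "v \<in> {1..n}" "\<not> connected E k v"
  shows "insert {k, v} E \<in> rooted_forests n (k - 1)"
proof (rule rooted_forestsI)
  let ?E = "insert {k, v} E"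
  have "v \<noteq> k" using v by auto
  then show "simple_graph {1..n} ?E"
    using E k v unfolding rooted_forests_iff[OF k(2)] by (auto simp: simple_graph_def)
  show "all_bridges ?E"
    using E v(2) unfolding rooted_forests_iff[OF k(2)] by (simp add: all_bridges_insert)
  fix x assume "x \<in> {1..n}"
  then obtain r where r: "r \<in> {1..k}" "connected E x r"
    by (rule rooted_forests_root[OF k(2) E])
  obtain s where s: "s \<in> {1..k}" "connected E v s"
    by (rule rooted_forests_root[OF k(2) E v(1)])
  have "s \<noteq> k" using v s connected_sym by metis
  then have "s \<in> {1..k - 1}" using s by auto
  moreover have "connected ?E x r" by (simp add: connected_insert r)
  moreover have "connected ?E x s" if "r = k"
    using that r s by (auto simp: connected_insert)
  ultimately show "\<exists>r\<in>{1..k - 1}. connected ?E x r"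
    using r(1) by (cases "r = k") auto
next
  fix r s assume r: "r \<in> {1..k - 1}" and s: "s \<in> {1..k - 1}"
    and c: "connected (insert {k, v} E) r s"
  have mem: "r \<in> {1..k}" "s \<in> {1..k}" "k \<in> {1..k}" "r \<noteq> k" "s \<noteq> k"
    using r s k by auto
  then have "\<not> connected E r k" "\<not> connected E k s"
    using rooted_forests_root_unique[OF k(2) E, of r k]
      rooted_forests_root_unique[OF k(2) E, of k s] by auto
  then have "connected E r s" using c by (auto simp: connected_insert)
  then show "r = s"
    using rooted_forests_root_unique[OF k(2) E, of r s] mem by auto
qed (use k in auto)

text \<open>Take for \<open>v\<close> the parent of \<open>k\<close>, the neighbour of
  \<open>k\<close> on the way to its root \<open>r\<close>; without the edge \<open>{k, v}\<close>,
  \<open>k\<close> is the root of its own tree.\<close>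

lemma detach_root:
  assumes k: "1 < k" "k \<le> n" and F: "F \<in> rooted_forests n (k - 1)"
  obtains E v where "E \<in> rooted_forests n k" "v \<in> {1..n}" "\<not> connected E k v"
    "F = insert {k, v} E"
proof -
  have k': "k - 1 \<le> n" using k by simp
  have kn: "k \<in> {1..n}" using k by auto
  obtain r where r: "r \<in> {1..k - 1}" "connected F k r"
    by (rule rooted_forests_root[OF k' F kn])
  have "r \<noteq> k" using r k by auto
  obtain v where v: "{k, v} \<in> F" "connected (F - {{k, v}}) r v"
    using connected_last_edge[OF connected_sym[OF r(2)] \<open>r \<noteq> k\<close>] by blast
  define E where "E = F - {{k, v}}"
  have FE: "F = insert {k, v} E" using v(1) by (auto simp: E_def)
  have sg: "simple_graph {1..n} F" and ab: "all_bridges F"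
    using F unfolding rooted_forests_iff[OF k'] by auto
  have "v \<in> {1..n}" using sg v(1) by (auto simp: simple_graph_def)
  have nc: "\<not> connected E k v"
    using ab v(1) by (auto simp: all_bridges_def E_def)
  have rv: "connected E r v" using v(2) by (simp add: E_def)
  have rk: "\<not> connected E r k" using nc rv connected_sym connected_trans by metis
  have mono: "connected F x y" if "connected E x y" for x y
    by (simp add: FE connected_insert that)
  \<comment> \<open>Among the old roots only \<open>r\<close> was connected to \<open>k\<close>, and
    the removal has separated these two.\<close>
  have not_k: "\<not> connected E s k" if s: "s \<in> {1..k - 1}" for s
  proof
    assume c: "connected E s k"
    then have "connected F s r" using mono r(2) connected_trans by metis
    then have "s = r" using rooted_forests_root_unique[OF k' F s r(1)] by simp
    with c rk show False by simp
  qed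
  have "E \<in> rooted_forests n k"
  proof (rule rooted_forestsI)
    show "simple_graph {1..n} E" using sg by (auto simp: simple_graph_def E_def)
    show "all_bridges E" using ab by (rule all_bridges_subset) (auto simp: E_def)
    fix x assume "x \<in> {1..n}"
    then obtain s where s: "s \<in> {1..k - 1}" "connected F x s"
      by (rule rooted_forests_root[OF k' F])
    \<comment> \<open>If the walk to \<open>s\<close> used the removed edge, then \<open>x\<close>
      still reaches the end where it entered: either \<open>k\<close>, now a root, or
      \<open>v\<close>, which is still joined to \<open>r\<close>.\<close>
    then have "connected E x s \<or> connected E x k \<or> connected E x v"
      unfolding FE connected_insert by blast
    moreover have "connected E x r" if "connected E x v"
      using that rv connected_sym connected_trans by metis
    moreover have "s \<in> {1..k}" "r \<in> {1..k}" "k \<in> {1..k}" using s r k by auto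
    ultimately show "\<exists>r\<in>{1..k}. connected E x r" by blast
  next
    fix s t assume s: "s \<in> {1..k}" and t: "t \<in> {1..k}" and c: "connected E s t"
    show "s = t"
    proof (cases "s = k \<or> t = k")
      case True
      moreover have "s \<in> {1..k - 1}" if "s \<noteq> k" using s that by auto
      moreover have "t \<in> {1..k - 1}" if "t \<noteq> k" using t that by auto
      ultimately show ?thesis using not_k c connected_sym by metis
    next
      case False
      then have "s \<in> {1..k - 1}" "t \<in> {1..k - 1}" using s t by auto
      then show ?thesis using rooted_forests_root_unique[OF k' F] mono[OF c] by blast
    qed
  qed (use k in auto)
  then show thesis using \<open>v \<in> {1..n}\<close> nc FE by (rule that)
qed

text \<open>The parent of \<open>k\<close> is determined by the new forest. If \<open>v\<close> and
  \<open>v'\<close> differed, then \<open>{k, v'}\<close> would lie in \<open>E\<close>, and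
  \<open>k\<close> would reach in \<open>E\<close> the root that \<open>v'\<close> has in
  \<open>E'\<close>, a root other than \<open>k\<close>.\<close>

lemma attach_root_inj:
  assumes k: "1 < k" "k \<le> n" and E: "E \<in> rooted_forests n k" "E' \<in> rooted_forests n k"
    and v: "v' \<in> {1..n}" "\<not> connected E k v" "\<not> connected E' k v'"
    and eq: "insert {k, v} E = insert {k, v'} E'"
  shows "E = E' \<and> v = v'"
proof (cases "v = v'")
  case True
  have "{k, v} \<notin> E" "{k, v'} \<notin> E'" using v(2,3) connected_edge by metis+
  with True eq show ?thesis by (metis insert_ident)
next
  case False
  define E0 where "E0 = E - {{k, v'}}"
  have ne: "{k, v} \<noteq> {k, v'}" using False by (auto simp: doubleton_eq_iff)
  have "{k, v} \<notin> E" "{k, v'} \<notin> E'" using v(2,3) connected_edge by metis+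
  then have E_eq: "E = insert {k, v'} E0" and E'_eq: "E' = insert {k, v} E0"
    using eq ne unfolding E0_def by blast+
  obtain r where r: "r \<in> {1..k}" "connected E' v' r"
    by (rule rooted_forests_root[OF k(2) E(2) v(1)])
  then have "r \<noteq> k" using v(3) connected_sym by metis
  have "\<not> connected E' v' k" using v(3) connected_sym by metis
  \<comment> \<open>A walk from \<open>v'\<close> through \<open>{k, v}\<close> would visit
    \<open>k\<close>, so the walk to \<open>r\<close> stays within the common part of
    \<open>E\<close> and \<open>E'\<close>.\<close>
  then have "connected E0 v' r"
    using r(2) unfolding E'_eq connected_insert using connected_refl by metis
  then have "connected E k r"
    unfolding E_eq connected_insert using connected_refl by metis
  then have "k = r" using rooted_forests_root_unique[OF k(2) E(1), of k r] k r(1) by auto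
  with \<open>r \<noteq> k\<close> show ?thesis by simp
qed

section \<open>Exchanging two roots\<close>

context
  fixes n k a b :: nat
  assumes kn: "k \<le> n" and a: "a \<in> {1..k}" and b: "b \<in> {1..k}"
begin

text \<open>The transposition of \<open>a\<close> and \<open>b\<close>, acting on edges and on edge
  sets by taking images.\<close>

abbreviation (input) swap :: "nat \<Rightarrow> nat" where
  "swap \<equiv> id(a := b, b := a)"

lemma swap_swap: "swap (swap x) = x"
  by auto

text \<open>Needed with \<open>m = k\<close> for roots and with \<open>m = n\<close> for
  vertices.\<close>

lemma swap_mem: "k \<le> m \<Longrightarrow> x \<in> {1..m} \<Longrightarrow> swap x \<in> {1..m}"
  using a b by auto

lemma swap_swap_edges: "(`) swap ` (`) swap ` E = E"
  by (simp only: image_image swap_swap image_ident)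

lemma connected_swap: "connected ((`) swap ` E) x y \<longleftrightarrow> connected E (swap x) (swap y)"
  using connected_image[of "(`) swap ` E" x y swap] connected_image[of E "swap x" "swap y" swap]
  by (metis swap_swap_edges swap_swap)

text \<open>The relabelling is an isomorphism of graphs that permutes both the vertices
  \<open>{1..n}\<close> and the roots \<open>{1..k}\<close>.\<close>

lemma rooted_forests_swap:
  assumes E: "E \<in> rooted_forests n k"
  shows "(`) swap ` E \<in> rooted_forests n k"
proof (rule rooted_forestsI[OF kn])
  have inj: "inj swap" by (rule inj_on_inverseI) (rule swap_swap)
  have sg: "simple_graph {1..n} E" and ab: "all_bridges E"
    using E unfolding rooted_forests_iff[OF kn] by auto
  show "simple_graph {1..n} ((`) swap ` E)"
    unfolding simple_graph_def
  proof
    fix e assume "e \<in> (`) swap ` E"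
    then obtain d where d: "d \<in> E" "e = swap ` d" by blast
    then have "d \<subseteq> {1..n}" "card d = 2" using sg by (auto simp: simple_graph_def)
    then show "e \<subseteq> {1..n} \<and> card e = 2"
      unfolding d(2) using swap_mem[OF kn] inj
      by (metis card_image image_subsetI inj_on_subset subset_UNIV subsetD)
  qed
  show "all_bridges ((`) swap ` E)" using ab inj by (rule all_bridges_image)
  fix x assume "x \<in> {1..n}"
  then obtain r where "r \<in> {1..k}" "connected E (swap x) r"
    using rooted_forests_root[OF kn E] swap_mem[OF kn] by metis
  then show "\<exists>r\<in>{1..k}. connected ((`) swap ` E) x r"
    unfolding connected_swap using swap_mem[OF order_refl] swap_swap by metis
next
  fix r s assume "r \<in> {1..k}" "s \<in> {1..k}" "connected ((`) swap ` E) r s"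
  then have "swap r = swap s"
    unfolding connected_swap using rooted_forests_root_unique[OF kn E] swap_mem[OF order_refl] by metis
  then show "r = s" using swap_swap by metis
qed

text \<open>The relabelling is an involution on the forests that exchanges the trees of
  \<open>a\<close> and \<open>b\<close> up to renaming, hence with their sizes, and it fixes
  \<open>x\<close>.\<close>

lemma sum_swap_roots:
  assumes "x \<noteq> a" "x \<noteq> b"
  shows "(\<Sum>E | E \<in> rooted_forests n k \<and> connected E b x. card {v \<in> {1..n}. connected E a v}) =
         (\<Sum>E | E \<in> rooted_forests n k \<and> connected E a x. card {v \<in> {1..n}. connected E b v})"
proof (rule sum.reindex_bij_witness[where i = "(`) ((`) swap)" and j = "(`) ((`) swap)"])
  fix E
  have ba: "swap b = a" by simp
  have "bij_betw swap {v \<in> {1..n}. connected E a v}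
      {v \<in> {1..n}. connected ((`) swap ` E) b v}"
  proof (rule bij_betw_byWitness[where f' = swap])
    have eq: "connected ((`) swap ` E) b (swap v) \<longleftrightarrow> connected E a v" for v
      by (simp only: connected_swap ba swap_swap)
    show "swap ` {v \<in> {1..n}. connected E a v} \<subseteq> {v \<in> {1..n}. connected ((`) swap ` E) b v}"
    proof (rule image_subsetI)
      fix v assume "v \<in> {v \<in> {1..n}. connected E a v}"
      then show "swap v \<in> {v \<in> {1..n}. connected ((`) swap ` E) b v}"
        unfolding mem_Collect_eq eq using swap_mem[OF kn, of v] by blast
    qed
    show "swap ` {v \<in> {1..n}. connected ((`) swap ` E) b v} \<subseteq> {v \<in> {1..n}. connected E a v}"
    proof (rule image_subsetI)
      fix v assume "v \<in> {v \<in> {1..n}. connected ((`) swap ` E) b v}"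
      then show "swap v \<in> {v \<in> {1..n}. connected E a v}"
        unfolding mem_Collect_eq connected_swap ba using swap_mem[OF kn, of v] by blast
    qed
  qed (simp_all only: swap_swap simp_thms ball_simps)
  then show "card {v \<in> {1..n}. connected ((`) swap ` E) b v} = card {v \<in> {1..n}. connected E a v}"
    by (rule bij_betw_same_card[symmetric])
next
  have sw: "swap a = b" "swap b = a" "swap x = x" using assms by auto
  fix E
  show "(`) swap ` (`) swap ` E = E" "(`) swap ` (`) swap ` E = E"
    by (rule swap_swap_edges)+
  show "(`) swap ` E \<in> {E \<in> rooted_forests n k. connected E a x}"
    if "E \<in> {E \<in> rooted_forests n k. connected E b x}"
    using that rooted_forests_swap unfolding mem_Collect_eq connected_swap sw by blast
  show "(`) swap ` E \<in> {E \<in> rooted_forests n k. connected E b x}"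
    if "E \<in> {E \<in> rooted_forests n k. connected E a x}"
    using that rooted_forests_swap unfolding mem_Collect_eq connected_swap sw by blast
qed

end

section \<open>Counting\<close>

theorem theorem2p1:
  fixes n k :: nat
  assumes "2 \<le> k" and "k \<le> n - 1"
  shows "card (rooted_forests_desc n (k - 1) n 1) = n * card (rooted_forests_desc n k n 1)"
proof -
  have k: "1 < k" "k \<le> n" "k < n" using assms by auto
  let ?F = "rooted_forests n k"
  let ?T = "\<lambda>E r. {v \<in> {1..n}. connected E r v}"
  define A where "A = {E \<in> ?F. connected E 1 n}"
  define B where "B = {E \<in> ?F. connected E k n}"
  \<comment> \<open>\<open>P\<close> and \<open>Q\<close> pair each forest with the vertices
    \<open>v\<close> under which \<open>k\<close> may be attached so that \<open>n\<close> ends up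
    below \<open>1\<close>.\<close>
  define P where "P = (SIGMA E:A. {1..n} - ?T E k)"
  define Q where "Q = (SIGMA E:B. ?T E 1)"
  have fin: "finite A" "finite B" by (simp_all add: A_def B_def finite_rooted_forests)
  have neq: "\<not> connected E 1 k" if "E \<in> ?F" for E
    using rooted_forests_root_unique[OF k(2) that, of 1 k] k by auto
  then have disj: "P \<inter> Q = {}"
    unfolding P_def Q_def A_def B_def using connected_sym connected_trans
    by fastforce
  \<comment> \<open>Of the three ways to get from \<open>1\<close> to \<open>n\<close>, the one that
    enters the new edge at \<open>k\<close> is impossible, as \<open>1\<close> does not reach
    \<open>k\<close> in \<open>E\<close>. The other two give \<open>P\<close> and
    \<open>Q\<close>.\<close>
  have PQ: "(E, v) \<in> P \<union> Q \<longleftrightarrow> E \<in> ?F \<and> v \<in> {1..n} \<and> \<not> connected E k v \<and>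
      connected (insert {k, v} E) 1 n" for E v
  proof (cases "E \<in> ?F")
    case True
    have "\<not> connected E k v" if "connected E 1 v"
      using neq[OF True] that connected_sym connected_trans by metis
    then show ?thesis
      using True neq[OF True] by (auto simp: P_def Q_def A_def B_def connected_insert)
  qed (auto simp: P_def Q_def A_def B_def)
  have "bij_betw (\<lambda>(E, v). insert {k, v} E) (P \<union> Q) (rooted_forests_desc n (k - 1) n 1)"
    unfolding bij_betw_def
  proof
    show "inj_on (\<lambda>(E, v). insert {k, v} E) (P \<union> Q)"
    proof (rule inj_onI, clarify)
      fix E v E' v'
      assume "(E, v) \<in> P \<union> Q" "(E', v') \<in> P \<union> Q" "insert {k, v} E = insert {k, v'} E'"
      then show "E = E' \<and> v = v'"
        unfolding PQ using attach_root_inj[OF k(1,2)] by metis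
    qed
    have desc: "rooted_forests_desc n (k - 1) n 1 = {F \<in> rooted_forests n (k - 1). connected F 1 n}"
      using k by (intro rooted_forests_desc_root) auto
    show "(\<lambda>(E, v). insert {k, v} E) ` (P \<union> Q) = rooted_forests_desc n (k - 1) n 1"
      unfolding desc
    proof (intro equalityI subsetI)
      fix F assume "F \<in> (\<lambda>(E, v). insert {k, v} E) ` (P \<union> Q)"
      then obtain E v where "(E, v) \<in> P \<union> Q" "F = insert {k, v} E" by auto
      then show "F \<in> {F \<in> rooted_forests n (k - 1). connected F 1 n}"
        unfolding PQ using attach_root[OF k(1,2)] by blast
    next
      fix F assume "F \<in> {F \<in> rooted_forests n (k - 1). connected F 1 n}"
      then have F: "F \<in> rooted_forests n (k - 1)" "connected F 1 n" by auto
      from k(1,2) F(1) obtain E v where "E \<in> ?F" "v \<in> {1..n}" "\<not> connected E k v"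
        "F = insert {k, v} E"
        by (rule detach_root)
      then have "(E, v) \<in> P \<union> Q" "F = insert {k, v} E" unfolding PQ using F(2) by auto
      then show "F \<in> (\<lambda>(E, v). insert {k, v} E) ` (P \<union> Q)" by force
    qed
  qed
  then have "card (rooted_forests_desc n (k - 1) n 1) = card (P \<union> Q)"
    by (simp add: bij_betw_same_card)
  also have "\<dots> = card P + card Q"
    using fin disj by (intro card_Un_disjoint) (auto simp: P_def Q_def)
  also have "card Q = (\<Sum>E\<in>B. card (?T E 1))"
    using fin by (simp add: Q_def)
  \<comment> \<open>Here \<open>k < n\<close> matters: \<open>n\<close> differs from both exchanged
    roots and keeps its label.\<close>
  also have "\<dots> = (\<Sum>E\<in>A. card (?T E k))"
    unfolding A_def B_def using k by (intro sum_swap_roots) auto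
  also have "card P = (\<Sum>E\<in>A. card ({1..n} - ?T E k))"
    using fin by (simp add: P_def)
  also have "\<dots> + (\<Sum>E\<in>A. card (?T E k)) =
      (\<Sum>E\<in>A. card ({1..n} - ?T E k) + card (?T E k))"
    by (rule sum.distrib[symmetric])
  \<comment> \<open>In each summand the tree of \<open>k\<close> and its complement make up all
    \<open>n\<close> vertices.\<close>
  also have "\<dots> = (\<Sum>E\<in>A. n)"
  proof (rule sum.cong)
    fix E
    have "?T E k \<subseteq> {1..n}" by blast
    then show "card ({1..n} - ?T E k) + card (?T E k) = n"
      by (metis (no_types, lifting) add.commute card_Diff_subset card_atLeastAtMost card_mono
          diff_Suc_1 finite_atLeastAtMost finite_subset le_add_diff_inverse)
  qed simp
  also have "\<dots> = n * card (rooted_forests_desc n k n 1)"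
    using k by (simp add: A_def rooted_forests_desc_root)
  finally show ?thesis .
qed

end
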